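(* Let $\Gamma$ be a metrized graph with $\ell(\Gamma)=1$ having $v$ vertices and $e$ edges, all of equal length $\frac1e$, and let $g=e-v+1$. Then $$\tau(\Gamma)\ge\frac1{12}\Big(\frac ge\Big)^2+\frac1{2v}\Big(\frac{v-1}{e}\Big)^2.$$
   Context: A metrized graph is a finite connected graph (multiple edges and self-loops allowed) with a finite non-empty vertex set containing all points of valence $\neq 2$, in which each edge is identified with a closed interval of positive length; $\ell(\Gamma)$ is the total length. Regard $\Gamma$ as a resistive circuit with resistance of each segment equal to its length; $r(x,y)$ is the effective resistance. The tau constant is $\tau(\Gamma)=\frac14\int_\Gamma\big(\frac{\partial}{\partial x}r(x,y)\big)^2dx$ (independent of $y$). *)

theory Defs
  imports "HOL-Analysis.Analysis" "Graph_Theory.Digraph_Component"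
begin

text \<open>
  A metrized graph is represented by a finite multi-digraph whose arcs are the edges, each with an
  arbitrarily chosen orientation, together with the edge lengths.  The arc \<open>e\<close> is identified with
  the interval from \<open>0\<close> (its tail) to \<open>len e\<close> (its head).  Interior points of edges
  have valence 2, so every point of valence other than 2 is a vertex.
  Connectedness ignores the orientation and includes non-emptiness of the vertex set.
\<close>

locale metrized_graph = fin_digraph G
  for G :: "('a, 'b) pre_digraph" (structure) +
  fixes len :: "'b \<Rightarrow> real"
  assumes connected_graph: "Digraph_Component.connected G"
    and len_pos: "e \<in> arcs G \<Longrightarrow> 0 < len e"

definition total_length :: "('a, 'b) pre_digraph \<Rightarrow> ('b \<Rightarrow> real) \<Rightarrow> real" where
  "total_length G len = (\<Sum>e\<in>arcs G. len e)"

datatype ('a, 'b) mg_point = Vertex 'a | Inner 'b real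

definition mg_points :: "('a, 'b) pre_digraph \<Rightarrow> ('b \<Rightarrow> real) \<Rightarrow> ('a, 'b) mg_point set" where
  "mg_points G len =
     Vertex ` verts G \<union> {Inner e t | e t. e \<in> arcs G \<and> 0 < t \<and> t < len e}"

text \<open>The parametrisation of the edge \<open>e\<close>; only arguments in \<open>{0..len e}\<close> matter.\<close>

definition edge_pt ::
    "('a, 'b) pre_digraph \<Rightarrow> ('b \<Rightarrow> real) \<Rightarrow> 'b \<Rightarrow> real \<Rightarrow> ('a, 'b) mg_point" where
  "edge_pt G len e t =
     (if t \<le> 0 then Vertex (tail G e)
      else if len e \<le> t then Vertex (head G e)
      else Inner e t)"

text \<open>
  Marking a finite set \<open>S\<close> of points that contains all vertices cuts the edges into segments.
  The triple \<open>(e, a, b)\<close> stands for the part of \<open>e\<close> between two consecutive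
  marked points \<open>a < b\<close>; as a resistor it has resistance \<open>b - a\<close>.
\<close>

definition cuts :: "('b \<Rightarrow> real) \<Rightarrow> ('a, 'b) mg_point set \<Rightarrow> 'b \<Rightarrow> real set" where
  "cuts len S e = {0, len e} \<union> {t. 0 < t \<and> t < len e \<and> Inner e t \<in> S}"

definition segments ::
    "('a, 'b) pre_digraph \<Rightarrow> ('b \<Rightarrow> real) \<Rightarrow> ('a, 'b) mg_point set \<Rightarrow> ('b \<times> real \<times> real) set" where
  "segments G len S =
     {(e, a, b). e \<in> arcs G \<and> a \<in> cuts len S e \<and> b \<in> cuts len S e \<and> a < b \<and>
        {a<..<b} \<inter> cuts len S e = {}}"

text \<open>
  The net current leaving \<open>p\<close> in the circuit with nodes \<open>S\<close> under the potential \<open>f\<close>.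
  By Ohm's law a segment carries the current \<open>(f P - f Q) / (b - a)\<close> from its initial
  point \<open>P\<close> to its final point \<open>Q\<close>.  If \<open>P = Q\<close> it contributes nothing.
\<close>

definition net_current ::
    "('a, 'b) pre_digraph \<Rightarrow> ('b \<Rightarrow> real) \<Rightarrow> ('a, 'b) mg_point set \<Rightarrow>
     (('a, 'b) mg_point \<Rightarrow> real) \<Rightarrow> ('a, 'b) mg_point \<Rightarrow> real" where
  "net_current G len S f p =
     (\<Sum>(e, a, b)\<in>segments G len S.
        (f (edge_pt G len e a) - f (edge_pt G len e b)) / (b - a) *
        (of_bool (edge_pt G len e a = p) - of_bool (edge_pt G len e b = p)))"

text \<open>Kirchhoff's current law when a unit current enters at \<open>x\<close> and leaves at \<open>y\<close>.\<close>

definition unit_current_potential ::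
    "('a, 'b) pre_digraph \<Rightarrow> ('b \<Rightarrow> real) \<Rightarrow> ('a, 'b) mg_point set \<Rightarrow>
     ('a, 'b) mg_point \<Rightarrow> ('a, 'b) mg_point \<Rightarrow> (('a, 'b) mg_point \<Rightarrow> real) \<Rightarrow> bool" where
  "unit_current_potential G len S x y f \<longleftrightarrow>
     (\<forall>p\<in>S. net_current G len S f p = of_bool (p = x) - of_bool (p = y))"

definition eff_resistance ::
    "('a, 'b) pre_digraph \<Rightarrow> ('b \<Rightarrow> real) \<Rightarrow> ('a, 'b) mg_point \<Rightarrow> ('a, 'b) mg_point \<Rightarrow> real" where
  "eff_resistance G len x y =
     (THE \<rho>. \<exists>f. unit_current_potential G len (Vertex ` verts G \<union> {x, y}) x y f \<and> \<rho> = f x - f y)"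

text \<open>
  The base point \<open>y\<close> is kept as an argument: the value does not depend on it, but this is
  a theorem.  On each edge the resistance to \<open>y\<close> is differentiable off a finite set.
\<close>

definition tau_constant ::
    "('a, 'b) pre_digraph \<Rightarrow> ('b \<Rightarrow> real) \<Rightarrow> ('a, 'b) mg_point \<Rightarrow> real" where
  "tau_constant G len y =
     1 / 4 * (\<Sum>e\<in>arcs G. integral {0..len e}
       (\<lambda>t. (deriv (\<lambda>s. eff_resistance G len (edge_pt G len e s) y) t)\<^sup>2))"

end

theory Submission
  imports Defs "Jordan_Normal_Form.Determinant"
begin

text \<open>
  Let \<open>Q\<close> be the Green matrix of the weighted graph Laplacian \<open>\<Delta>\<close>, so that
  \<open>\<Delta> Q = I - J / v\<close>, and let \<open>D\<close> be its diagonal.  A unit current injected in the interior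
  of an edge is equivalent to currents at its two endpoints, distributed by linear interpolation,
  plus the Dirichlet Green function of the interval.  Hence \<open>r(x, y)\<close> is explicitly piecewise
  quadratic in \<open>x\<close> on each edge, and integrating the squared derivative gives, for every base point,
  \<open>\<tau> = 1/12 \<Sum> L\<^sub>e (1 - r\<^sub>e / L\<^sub>e)\<^sup>2 + 1/4 \<langle>D, \<Delta> D\<rangle> + tr Q / v\<close>, where \<open>r\<^sub>e\<close> is the resistance between
  the endpoints of \<open>e\<close>.  Foster's identity \<open>\<Sum> r\<^sub>e / L\<^sub>e = v - 1\<close> and the Cauchy--Schwarz inequality
  bound the first sum; the second term is nonnegative; and \<open>tr Q \<cdot> tr \<Delta> \<ge> (v - 1)\<^sup>2\<close> with
  \<open>tr \<Delta> \<le> \<Sum> 2 / L\<^sub>e\<close> bounds the third.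
\<close>

section \<open>Linear systems and piecewise affine functions\<close>

text \<open>Trivial kernel gives a nonzero determinant and hence a right inverse. The enumeration
  \<open>h\<close> transfers this from matrices indexed by numbers to families indexed by
  \<open>V\<close>.\<close>

lemma linear_system_solvable:
  fixes A :: "'a \<Rightarrow> 'a \<Rightarrow> real" and b :: "'a \<Rightarrow> real"
  assumes fin: "finite V"
    and ker: "\<And>f. (\<And>i. i \<in> V \<Longrightarrow> (\<Sum>j\<in>V. A i j * f j) = 0) \<Longrightarrow> \<forall>i\<in>V. f i = 0"
  shows "\<exists>f. \<forall>i\<in>V. (\<Sum>j\<in>V. A i j * f j) = b i"
proof -
  define n where "n = card V"
  obtain h where h: "bij_betw h {0..<n} V"
    using ex_bij_betw_nat_finite[OF fin] n_def by blast
  define k where "k = inv_into {0..<n} h"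
  have k: "bij_betw k V {0..<n}"
    unfolding k_def by (rule bij_betw_inv_into[OF h])
  have hk: "h (k i) = i" if "i \<in> V" for i
    using bij_betw_inv_into_right[OF h that] by (simp add: k_def)
  have kh: "k (h i) = i" if "i < n" for i
    using bij_betw_inv_into_left[OF h, of i] that by (simp add: k_def)
  have kn: "k i < n" if "i \<in> V" for i
    using bij_betwE[OF k] that by auto
  have hV: "h i \<in> V" if "i < n" for i
    using bij_betwE[OF h] that by auto
  define M where "M = Matrix.mat n n (\<lambda>(i, j). A (h i) (h j))"
  have M: "M \<in> carrier_mat n n"
    by (simp add: M_def)
  have row: "vec_index (M *\<^sub>v x) (k i) = (\<Sum>j\<in>V. A i j * vec_index x (k j))"
    if "i \<in> V" "x \<in> carrier_vec n" for i x
  proof -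
    have "vec_index (M *\<^sub>v x) (k i) = (\<Sum>j = 0..<n. A i (h j) * vec_index x j)"
      using that kn[OF that(1)] by (simp add: M_def scalar_prod_def hk)
    also have "\<dots> = (\<Sum>j = 0..<n. A i (h j) * vec_index x (k (h j)))"
      by (rule sum.cong) (simp_all add: kh)
    also have "\<dots> = (\<Sum>j\<in>V. A i j * vec_index x (k j))"
      by (rule sum.reindex_bij_betw[OF h])
    finally show ?thesis .
  qed
  have "Determinant.det M \<noteq> 0"
  proof
    assume "Determinant.det M = 0"
    then obtain x where x: "x \<in> carrier_vec n" "x \<noteq> 0\<^sub>v n" "M *\<^sub>v x = 0\<^sub>v n"
      using det_0_iff_vec_prod_zero[OF M] by auto
    have "\<forall>i\<in>V. vec_index x (k i) = 0"
      by (rule ker) (use row[OF _ x(1)] x(3) kn in simp)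
    then have "vec_index x i = 0" if "i < n" for i
      using hV[OF that] kh[OF that] by metis
    then have "x = 0\<^sub>v n"
      using x(1) by (intro eq_vecI) auto
    with x(2) show False by simp
  qed
  from det_non_zero_imp_unit[OF M this, of "()"]
  obtain B where B: "B \<in> carrier_mat n n" "M * B = 1\<^sub>m n"
    by (auto simp: Units_def ring_mat_def)
  define c where "c = Matrix.vec n (\<lambda>i. b (h i))"
  have c: "c \<in> carrier_vec n" by (simp add: c_def)
  have "M *\<^sub>v (B *\<^sub>v c) = c"
    using assoc_mult_mat_vec[OF M B(1) c] B(2) c by simp
  moreover have "vec_index c (k i) = b i" if "i \<in> V" for i
    using that by (simp add: c_def kn hk)
  ultimately have "\<forall>i\<in>V. (\<Sum>j\<in>V. A i j * vec_index (B *\<^sub>v c) (k j)) = b i"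
    using row[of _ "B *\<^sub>v c"] B(1) c by (metis mult_mat_vec_carrier)
  then show ?thesis
    by (intro exI[of _ "\<lambda>j. vec_index (B *\<^sub>v c) (k j)"])
qed

section \<open>Gaps of a finite set of reals and summation by parts on one edge\<close>

definition consecutive_pairs :: "real set \<Rightarrow> (real \<times> real) set" where
  "consecutive_pairs C = {(a, b). a \<in> C \<and> b \<in> C \<and> a < b \<and> {a<..<b} \<inter> C = {}}"

lemma finite_consecutive_pairs: "finite C \<Longrightarrow> finite (consecutive_pairs C)"
  by (rule finite_subset[of _ "C \<times> C"]) (auto simp: consecutive_pairs_def)

text \<open>Inserting a new maximum \<open>m\<close> adds exactly one gap, from the old maximum to
  \<open>m\<close>.\<close>

lemma sum_consecutive_pairs_telescope:
  fixes H :: "real \<Rightarrow> real"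
  assumes "finite C" "C \<noteq> {}"
  shows "(\<Sum>(a, b)\<in>consecutive_pairs C. H b - H a) = H (Max C) - H (Min C)"
  using assms
proof (induction C rule: finite_linorder_max_induct)
  case (insert m A)
  show ?case
  proof (cases "A = {}")
    case True
    then have "consecutive_pairs (insert m A) = {}"
      by (auto simp: consecutive_pairs_def)
    with True show ?thesis by simp
  next
    case False
    have lt: "a < m" if "a \<in> A" for a
      using insert that by auto
    have max: "Max A \<in> A" and max': "\<And>a. a \<in> A \<Longrightarrow> a \<le> Max A"
      using insert False by auto
    have "consecutive_pairs (insert m A) = insert (Max A, m) (consecutive_pairs A)"
    proof (intro equalityI subsetI)
      fix z assume "z \<in> consecutive_pairs (insert m A)"
      then obtain a b where z: "z = (a, b)" "a \<in> insert m A" "b \<in> insert m A" "a < b"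
          "{a<..<b} \<inter> insert m A = {}"
        by (auto simp: consecutive_pairs_def)
      have a: "a \<in> A" using z lt by force
      show "z \<in> insert (Max A, m) (consecutive_pairs A)"
      proof (cases "b = m")
        case True
        have "\<not> a < Max A" using z(5) True max lt[OF max] by auto
        then have "a = Max A" using max'[OF a] by simp
        with z True show ?thesis by simp
      next
        case False
        with z a show ?thesis by (auto simp: consecutive_pairs_def)
      qed
    next
      fix z assume "z \<in> insert (Max A, m) (consecutive_pairs A)"
      then show "z \<in> consecutive_pairs (insert m A)"
        using lt max max' by (force simp: consecutive_pairs_def)
    qed
    moreover have "(Max A, m) \<notin> consecutive_pairs A"
      using lt by (force simp: consecutive_pairs_def)
    ultimately have "(\<Sum>(a, b)\<in>consecutive_pairs (insert m A). H b - H a)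
        = H m - H (Max A) + (H (Max A) - H (Min A))"
      using insert False by (simp add: finite_consecutive_pairs)
    moreover have "Max (insert m A) = m"
      using insert less_imp_le[OF lt] by (intro Max_eqI) auto
    moreover have "Min (insert m A) = Min A"
      using insert False less_imp_le[OF lt[OF Min_in]] by (intro Min_eqI) auto
    ultimately show ?thesis by simp
  qed
qed simp

text \<open>The Green function of \<open>-d\<^sup>2/dt\<^sup>2\<close> on \<open>[0, L]\<close> with Dirichlet boundary conditions.\<close>

definition bump :: "real \<Rightarrow> real \<Rightarrow> real \<Rightarrow> real" where
  "bump L s t = min s t * (L - max s t) / L"

lemma bump_commute: "bump L s t = bump L t s"
  by (simp add: bump_def min.commute max.commute)

lemma bump_zero: "0 \<le> t \<Longrightarrow> bump L 0 t = 0"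
  by (simp add: bump_def)

lemma bump_ends: "0 \<le> s \<Longrightarrow> bump L s 0 = 0" "s \<le> L \<Longrightarrow> bump L s L = 0"
  by (simp_all add: bump_def)

text \<open>Summation by parts: the potential has slope \<beta> + 1 - s / L before \<open>s\<close>
  and \<beta> - s / L after it. The affine part yields the edge's ordinary energy term; the kink at
  \<open>s\<close> yields a unit source there, balanced by its barycentric shares at the two
  ends.\<close>

lemma sum_consecutive_pairs_bump:
  fixes \<eta> :: "real \<Rightarrow> real"
  assumes C: "finite C" "C \<subseteq> {0..L}" "0 \<in> C" "L \<in> C" "s \<in> C" and L: "0 < L"
  shows "(\<Sum>(a, b)\<in>consecutive_pairs C.
            (\<alpha> + \<beta> * a + bump L s a - (\<alpha> + \<beta> * b + bump L s b)) / (b - a) * (\<eta> a - \<eta> b))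
         = \<beta> * (\<eta> L - \<eta> 0) + (\<eta> s - (1 - s / L) * \<eta> 0 - s / L * \<eta> L)"
proof -
  \<comment> \<open>Slope times \<eta>, shifted so that both branches agree at \<open>s\<close>; the
    gaps on the two sides then telescope through \<open>s\<close>.\<close>
  define H where
    "H t = \<beta> * \<eta> t + (if t \<le> s then 1 - s / L else - (s / L)) * (\<eta> t - \<eta> s)" for t
  have "(\<alpha> + \<beta> * a + bump L s a - (\<alpha> + \<beta> * b + bump L s b)) / (b - a) * (\<eta> a - \<eta> b) = H b - H a"
    if "(a, b) \<in> consecutive_pairs C" for a b
  proof -
    have ab: "a < b" "\<not> (a < s \<and> s < b)"
      using that C by (auto simp: consecutive_pairs_def)
    show ?thesis
    proof (cases "b \<le> s")
      case True
      with ab have "\<alpha> + \<beta> * a + bump L s a - (\<alpha> + \<beta> * b + bump L s b)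
          = - (\<beta> + (1 - s / L)) * (b - a)"
        using L by (simp add: bump_def field_simps)
      then have slope: "(\<alpha> + \<beta> * a + bump L s a - (\<alpha> + \<beta> * b + bump L s b)) / (b - a) = - (\<beta> + (1 - s / L))"
        using ab by (simp only:) simp
      show ?thesis
        unfolding slope using ab True by (simp add: H_def algebra_simps)
    next
      case False
      with ab have s: "s \<le> a" by simp
      with ab have "\<alpha> + \<beta> * a + bump L s a - (\<alpha> + \<beta> * b + bump L s b)
          = - (\<beta> - s / L) * (b - a)"
        using L by (simp add: bump_def field_simps)
      then have slope: "(\<alpha> + \<beta> * a + bump L s a - (\<alpha> + \<beta> * b + bump L s b)) / (b - a) = - (\<beta> - s / L)"
        using ab by (simp only:) simp
      show ?thesis
        unfolding slope using ab False s by (cases "a = s") (simp_all add: H_def algebra_simps)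
    qed
  qed
  then have "(\<Sum>(a, b)\<in>consecutive_pairs C.
      (\<alpha> + \<beta> * a + bump L s a - (\<alpha> + \<beta> * b + bump L s b)) / (b - a) * (\<eta> a - \<eta> b))
      = (\<Sum>(a, b)\<in>consecutive_pairs C. H b - H a)"
    by (intro sum.cong) auto
  also have "\<dots> = H (Max C) - H (Min C)"
    using C by (intro sum_consecutive_pairs_telescope) auto
  also have "Max C = L" using C by (intro Max_eqI) auto
  also have "Min C = 0" using C by (intro Min_eqI) auto
  also have "H L - H 0 = \<beta> * (\<eta> L - \<eta> 0) + (\<eta> s - (1 - s / L) * \<eta> 0 - s / L * \<eta> L)"
    using C L by (cases "L = s") (auto simp: H_def algebra_simps)
  finally show ?thesis .
qed

section \<open>Integrals of squared derivatives of piecewise quadratics\<close>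

lemma integral_square_affine:
  fixes a b \<alpha> \<beta> :: real
  assumes "a \<le> b"
  shows "((\<lambda>t. (\<alpha> + \<beta> * t)\<^sup>2) has_integral
           (\<alpha>\<^sup>2 * (b - a) + \<alpha> * \<beta> * (b\<^sup>2 - a\<^sup>2) + \<beta>\<^sup>2 * (b ^ 3 - a ^ 3) / 3)) {a..b}"
proof -
  define P where "P t = \<alpha>\<^sup>2 * t + \<alpha> * \<beta> * t\<^sup>2 + \<beta>\<^sup>2 * t ^ 3 / 3" for t
  have "((\<lambda>t. (\<alpha> + \<beta> * t)\<^sup>2) has_integral P b - P a) {a..b}"
  proof (rule fundamental_theorem_of_calculus[OF assms])
    fix t
    show "(P has_vector_derivative (\<alpha> + \<beta> * t)\<^sup>2) (at t within {a..b})"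
      unfolding P_def has_real_derivative_iff_has_vector_derivative[symmetric]
      by (auto intro!: derivative_eq_intros simp: power2_eq_square algebra_simps)
  qed
  also have "P b - P a
      = \<alpha>\<^sup>2 * (b - a) + \<alpha> * \<beta> * (b\<^sup>2 - a\<^sup>2) + \<beta>\<^sup>2 * (b ^ 3 - a ^ 3) / 3"
    by (simp add: P_def field_simps)
  finally show ?thesis .
qed

text \<open>Off \<open>0\<close>, \<open>s\<close> and \<open>L\<close> the derivative is affine,
  and finitely many points do not affect the integral. Mixed terms with \<open>A\<close> cancel
  because the other nonconstant summands vanish at both ends. For \<open>s = 0\<close> the bump is
  zero and the left piece degenerates.\<close>

lemma integral_square_deriv_bump:
  fixes \<rho> :: "real \<Rightarrow> real"
  assumes s: "0 \<le> s" "s < L"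
    and \<rho>: "\<And>t. 0 < t \<Longrightarrow> t < L \<Longrightarrow> \<rho> t = c + A * t + F * (t * (L - t) / L) - 2 * bump L s t"
  shows "integral {0..L} (\<lambda>t. (deriv \<rho> t)\<^sup>2)
         = L * A\<^sup>2 + F\<^sup>2 * L / 3 + 4 * (1 - F) * (s * (L - s) / L)"
proof -
  have L: "0 < L" using s by simp
  have left: "deriv \<rho> t = A + F - 2 * (1 - s / L) + (- 2 * F / L) * t"
    if "0 < t" "t < s" for t
  proof -
    have "\<forall>\<^sub>F x in nhds t. \<rho> x
        = c + A * x + F * (x * (L - x) / L) - 2 * (x * (L - s) / L)"
      by (rule eventually_mono[OF eventually_nhds_in_open[of "{0<..<s}" t]])
        (use that s \<rho> in \<open>auto simp: bump_def\<close>)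
    then have "deriv \<rho> t
        = deriv (\<lambda>x. c + A * x + F * (x * (L - x) / L) - 2 * (x * (L - s) / L)) t"
      by (rule deriv_cong_ev) simp
    also have "\<dots> = A + F - 2 * (1 - s / L) + (- 2 * F / L) * t"
      using L by (intro DERIV_imp_deriv)
        (auto intro!: derivative_eq_intros simp: field_simps power2_eq_square)
    finally show ?thesis .
  qed
  have right: "deriv \<rho> t = A + F + 2 * (s / L) + (- 2 * F / L) * t"
    if "s < t" "t < L" for t
  proof -
    have "\<forall>\<^sub>F x in nhds t. \<rho> x
        = c + A * x + F * (x * (L - x) / L) - 2 * (s * (L - x) / L)"
      by (rule eventually_mono[OF eventually_nhds_in_open[of "{s<..<L}" t]])
        (use that s \<rho> in \<open>auto simp: bump_def\<close>)
    then have "deriv \<rho> t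
        = deriv (\<lambda>x. c + A * x + F * (x * (L - x) / L) - 2 * (s * (L - x) / L)) t"
      by (rule deriv_cong_ev) simp
    also have "\<dots> = A + F + 2 * (s / L) + (- 2 * F / L) * t"
      using L by (intro DERIV_imp_deriv)
        (auto intro!: derivative_eq_intros simp: field_simps power2_eq_square)
    finally show ?thesis .
  qed
  have "((\<lambda>t. (deriv \<rho> t)\<^sup>2) has_integral
      ((A + F - 2 * (1 - s / L))\<^sup>2 * (s - 0) + (A + F - 2 * (1 - s / L)) * (- 2 * F / L) * (s\<^sup>2 - 0\<^sup>2)
       + (- 2 * F / L)\<^sup>2 * (s ^ 3 - 0 ^ 3) / 3)) {0..s}"
    by (rule has_integral_spike_finite[of "{0, s}",
          OF _ _ integral_square_affine[OF s(1), of "A + F - 2 * (1 - s / L)" "- 2 * F / L"]])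
      (use left in auto)
  moreover have "((\<lambda>t. (deriv \<rho> t)\<^sup>2) has_integral
      ((A + F + 2 * (s / L))\<^sup>2 * (L - s) + (A + F + 2 * (s / L)) * (- 2 * F / L) * (L\<^sup>2 - s\<^sup>2)
       + (- 2 * F / L)\<^sup>2 * (L ^ 3 - s ^ 3) / 3)) {s..L}"
    by (rule has_integral_spike_finite[of "{s, L}",
          OF _ _ integral_square_affine[OF less_imp_le[OF s(2)], of "A + F + 2 * (s / L)" "- 2 * F / L"]])
      (use right in auto)
  ultimately have "integral {0..L} (\<lambda>t. (deriv \<rho> t)\<^sup>2) = 
      ((A + F - 2 * (1 - s / L))\<^sup>2 * (s - 0) + (A + F - 2 * (1 - s / L)) * (- 2 * F / L) * (s\<^sup>2 - 0\<^sup>2)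
       + (- 2 * F / L)\<^sup>2 * (s ^ 3 - 0 ^ 3) / 3) +
      ((A + F + 2 * (s / L))\<^sup>2 * (L - s) + (A + F + 2 * (s / L)) * (- 2 * F / L) * (L\<^sup>2 - s\<^sup>2)
       + (- 2 * F / L)\<^sup>2 * (L ^ 3 - s ^ 3) / 3)"
    using s by (intro integral_unique) (rule has_integral_combine[of 0 s L]; simp)
  also have "\<dots> = L * A\<^sup>2 + F\<^sup>2 * L / 3 + 4 * (1 - F) * (s * (L - s) / L)"
    using L by (simp add: field_simps power2_eq_square power3_eq_cube)
  finally show ?thesis .
qed

section \<open>Dirichlet form and circuits\<close>

context metrized_graph
begin

text \<open>The weighted Laplacian in weak form: equations for it are stated by testing against
  every \<open>h\<close>. Self-loops contribute nothing.\<close>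

definition dirichlet :: "('a \<Rightarrow> real) \<Rightarrow> ('a \<Rightarrow> real) \<Rightarrow> real" where
  "dirichlet f h =
     (\<Sum>e\<in>arcs G. (f (head G e) - f (tail G e)) * (h (head G e) - h (tail G e)) / len e)"

lemma dirichlet_commute: "dirichlet f h = dirichlet h f"
  by (simp add: dirichlet_def mult.commute)

lemma dirichlet_linear_left:
  "dirichlet (\<lambda>p. a * f p + b * h p) k = a * dirichlet f k + b * dirichlet h k"
  unfolding dirichlet_def sum_distrib_left sum.distrib[symmetric]
  by (intro sum.cong refl) (simp add: algebra_simps add_divide_distrib diff_divide_distrib)

lemma dirichlet_linear_right:
  "dirichlet k (\<lambda>p. a * f p + b * h p) = a * dirichlet k f + b * dirichlet k h"
  using dirichlet_linear_left by (simp add: dirichlet_commute[of k])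

lemma dirichlet_const_left: "dirichlet (\<lambda>p. c) h = 0"
  by (simp add: dirichlet_def)

lemma dirichlet_self_nonneg: "0 \<le> dirichlet f f"
  unfolding dirichlet_def by (intro sum_nonneg) (auto dest: len_pos)

lemma dirichlet_diff_self:
  "dirichlet (\<lambda>p. f p - c * h p) (\<lambda>p. f p - c * h p)
     = dirichlet f f - 2 * c * dirichlet h f + c\<^sup>2 * dirichlet h h"
proof -
  define d where "d = (\<lambda>p. f p - c * h p)"
  have "dirichlet d d = dirichlet f d - c * dirichlet h d"
    using dirichlet_linear_left[of 1 f "- c" h d] by (simp add: d_def)
  moreover have "dirichlet f d = dirichlet f f - c * dirichlet h f"
    using dirichlet_linear_right[of f 1 f "- c" h] by (simp add: d_def dirichlet_commute[of f h])
  moreover have "dirichlet h d = dirichlet h f - c * dirichlet h h"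
    using dirichlet_linear_right[of h 1 f "- c" h] by (simp add: d_def)
  ultimately show ?thesis
    unfolding d_def[symmetric] by (simp add: algebra_simps power2_eq_square)
qed

text \<open>Vertex indicators suffice as test functions, which links the weak form to the Laplacian
  matrix.\<close>

lemma dirichlet_expand_right:
  "dirichlet f h = (\<Sum>p\<in>verts G. h p * dirichlet f (\<lambda>q. of_bool (q = p)))"
proof -
  have val: "(\<Sum>p\<in>verts G. h p * of_bool (q = p)) = h q" if "q \<in> verts G" for q
    using that by (simp add: of_bool_def if_distrib cong: if_cong)
  have "(\<Sum>p\<in>verts G. h p * dirichlet f (\<lambda>q. of_bool (q = p)))
      = (\<Sum>e\<in>arcs G. \<Sum>p\<in>verts G. h p * ((f (head G e) - f (tail G e))
           * (of_bool (head G e = p) - of_bool (tail G e = p)) / len e))"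
    by (simp add: dirichlet_def sum_distrib_left sum.swap[of _ "verts G"])
  also have "\<dots> = (\<Sum>e\<in>arcs G. (f (head G e) - f (tail G e)) / len e
       * ((\<Sum>p\<in>verts G. h p * of_bool (head G e = p)) - (\<Sum>p\<in>verts G. h p * of_bool (tail G e = p))))"
    unfolding sum_subtractf[symmetric] sum_distrib_left
    by (intro sum.cong refl) (simp add: algebra_simps diff_divide_distrib)
  also have "\<dots> = dirichlet f h"
    unfolding dirichlet_def by (intro sum.cong refl) (simp add: val)
  finally show ?thesis by simp
qed

text \<open>Zero energy forces equal values at the ends of every arc; a path in the symmetric
  closure then connects \<open>p\<close> to \<open>q\<close>.\<close>

lemma dirichlet_self_zero_imp_const:
  assumes "dirichlet f f = 0" "p \<in> verts G" "q \<in> verts G"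
  shows "f p = f q"
proof -
  have "\<forall>e\<in>arcs G. (f (head G e) - f (tail G e)) * (f (head G e) - f (tail G e)) / len e = 0"
    using assms(1) unfolding dirichlet_def
    by (subst (asm) sum_nonneg_eq_0_iff) (auto dest: len_pos)
  then have arc: "f (head G e) = f (tail G e)" if "e \<in> arcs G" for e
    using that len_pos[OF that] by auto
  have "p \<rightarrow>\<^sup>*\<^bsub>with_proj (mk_symmetric G)\<^esub> q"
    using connected_graph assms(2,3)
    by (auto simp: Digraph_Component.connected_def strongly_connected_def)
  then show ?thesis
    unfolding reachable_def
  proof (induction rule: rtrancl_on_induct)
    case (step x y)
    then show ?case using arc by (auto simp: parcs_mk_symmetric)
  qed simp
qed

section \<open>Existence of the discrete Green function\<close>

lemma verts_nonempty: "verts G \<noteq> {}"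
  using connected_graph by (auto simp: Digraph_Component.connected_def strongly_connected_def)

lemma card_verts_pos: "0 < card (verts G)"
  using verts_nonempty by (simp add: card_gt_0_iff)

text \<open>The Laplacian annihilates constants, so the system is solved for the Laplacian plus the
  all-ones matrix. Its quadratic form is the energy plus the squared vertex sum, which vanishes only
  for the zero function on the vertices. The solution is then recentred.\<close>

lemma ex_green_function_at:
  assumes p: "p \<in> verts G"
  shows "\<exists>f. sum f (verts G) = 0 \<and>
           (\<forall>h. dirichlet f h = h p - sum h (verts G) / card (verts G))"
proof -
  define one :: "'a \<Rightarrow> 'a \<Rightarrow> real" where "one = (\<lambda>p q. of_bool (q = p))"
  define n where "n = real (card (verts G))"
  have n: "n > 0" using card_verts_pos by (simp add: n_def)
  have row: "(\<Sum>j\<in>verts G. (dirichlet (one j) (one i) + 1) * f j)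
      = dirichlet f (one i) + sum f (verts G)" for f i
    unfolding dirichlet_commute[of f] dirichlet_commute[of _ "one i"]
    using dirichlet_expand_right[of "one i" f]
    by (simp add: one_def algebra_simps sum.distrib)
  have weak: "(\<Sum>i\<in>verts G. h i * (dirichlet f (one i) + sum f (verts G)))
      = dirichlet f h + sum f (verts G) * sum h (verts G)" for f h
    using dirichlet_expand_right[of f h]
    by (simp add: one_def algebra_simps sum.distrib sum_distrib_left)
  have "\<exists>f. \<forall>i\<in>verts G. (\<Sum>j\<in>verts G. (dirichlet (one j) (one i) + 1) * f j) = one p i"
  proof (rule linear_system_solvable)
    fix f assume "\<And>i. i \<in> verts G \<Longrightarrow> (\<Sum>j\<in>verts G. (dirichlet (one j) (one i) + 1) * f j) = 0"
    then have "dirichlet f f + sum f (verts G) * sum f (verts G) = 0"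
      using weak[of f f] row by simp
    then have 0: "dirichlet f f = 0" "sum f (verts G) = 0"
      using dirichlet_self_nonneg[of f]
      by (smt (verit) mult_eq_0_iff zero_le_square)+
    show "\<forall>i\<in>verts G. f i = 0"
    proof
      fix i assume i: "i \<in> verts G"
      have "sum f (verts G) = (\<Sum>j\<in>verts G. f i)"
        using dirichlet_self_zero_imp_const[OF 0(1) _ i] by (intro sum.cong) auto
      with 0 show "f i = 0" using verts_nonempty by simp
    qed
  qed simp
  then obtain f where f: "\<And>i. i \<in> verts G \<Longrightarrow> dirichlet f (one i) + sum f (verts G) = one p i"
    unfolding row by blast
  have *: "dirichlet f h + sum f (verts G) * sum h (verts G) = h p" for h
  proof -
    have "dirichlet f h + sum f (verts G) * sum h (verts G) = (\<Sum>i\<in>verts G. h i * one p i)"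
      unfolding weak[symmetric] by (simp add: f)
    also have "\<dots> = h p"
      using p by (simp add: one_def of_bool_def if_distrib cong: if_cong)
    finally show ?thesis .
  qed
  \<comment> \<open>Testing with the constant 1 kills the energy term and leaves
    \<open>n * sum f (verts G) = 1\<close>.\<close>
  have sf: "sum f (verts G) = 1 / n"
    using *[of "\<lambda>_. 1"] n dirichlet_const_left[of 1 f] dirichlet_commute[of f "\<lambda>_. 1"]
    by (simp add: n_def eq_divide_eq)
  \<comment> \<open>Subtracting the mean, \<open>1 / n\<close> divided by \<open>n\<close>, keeps
    all differences along arcs.\<close>
  define f' where "f' q = f q - 1 / n\<^sup>2" for q
  have "sum f' (verts G) = 0"
    using n by (simp add: f'_def sum_subtractf sf n_def power2_eq_square)
  moreover have "dirichlet f' h = h p - sum h (verts G) / card (verts G)" for h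
    using *[of h] by (simp add: dirichlet_def f'_def sf n_def)
  ultimately show ?thesis by blast
qed

section \<open>Interpolation and position of points on edges\<close>

definition interp :: "('a \<Rightarrow> real) \<Rightarrow> ('a, 'b) mg_point \<Rightarrow> real" where
  "interp f x = (case x of Vertex p \<Rightarrow> f p
     | Inner e t \<Rightarrow> (1 - t / len e) * f (tail G e) + t / len e * f (head G e))"

text \<open>The junk value \<open>0\<close> for points off the edge \<open>e\<close> makes \<open>bump (len e) (position e x)\<close> vanish
  there, so that no case distinction is needed below.\<close>

definition position :: "'b \<Rightarrow> ('a, 'b) mg_point \<Rightarrow> real" where
  "position e x = (case x of Vertex p \<Rightarrow> 0 | Inner e' t \<Rightarrow> if e' = e then t else 0)"

lemma interp_simps [simp]:
  "interp f (Vertex p) = f p"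
  "interp f (Inner e t) = (1 - t / len e) * f (tail G e) + t / len e * f (head G e)"
  by (simp_all add: interp_def)

lemma position_simps [simp]:
  "position e (Vertex p) = 0"
  "position e (Inner e' t) = (if e' = e then t else 0)"
  by (simp_all add: position_def)

lemma mg_points_cases [consumes 1, case_names Vertex Inner]:
  assumes "x \<in> mg_points G len"
  obtains p where "x = Vertex p" "p \<in> verts G"
    | e t where "x = Inner e t" "e \<in> arcs G" "0 < t" "t < len e"
  using assms by (auto simp: mg_points_def)

lemma interp_cong:
  "x \<in> mg_points G len \<Longrightarrow> (\<And>p. p \<in> verts G \<Longrightarrow> f p = h p) \<Longrightarrow> interp f x = interp h x"
  by (cases rule: mg_points_cases) auto

lemma interp_linear: "interp (\<lambda>p. a * f p + b * h p) x = a * interp f x + b * interp h x"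
  by (cases x) (simp_all add: algebra_simps)

lemma position_bounds:
  assumes "e \<in> arcs G" "x \<in> mg_points G len"
  shows "0 \<le> position e x" "position e x < len e"
  using assms len_pos[OF assms(1)] by (auto simp: mg_points_def)

text \<open>At most one edge has \<open>x\<close> in its interior; all others see position 0, where
  \<Phi> vanishes.\<close>

lemma sum_arcs_position:
  assumes x: "x \<in> mg_points G len"
    and 0: "\<And>e. \<Phi> e 0 = 0"
  shows "(\<Sum>e\<in>arcs G. \<Phi> e (position e x)) = (case x of Vertex p \<Rightarrow> 0 | Inner e t \<Rightarrow> \<Phi> e t)"
  using x
proof (cases rule: mg_points_cases)
  case (Inner e t)
  have "(\<Sum>e\<in>arcs G. \<Phi> e (position e x)) = (\<Sum>e'\<in>arcs G. if e = e' then \<Phi> e t else 0)"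
    using Inner(1) by (intro sum.cong) (auto simp: 0)
  with Inner show ?thesis by simp
qed (simp add: 0)

section \<open>Circuits with marked points as nodes\<close>

lemma segments_eq_Sigma:
  "segments G len S = (SIGMA e:arcs G. consecutive_pairs (cuts len S e))"
  by (auto simp: segments_def consecutive_pairs_def)

lemma finite_cuts:
  fixes S :: "('a, 'b) mg_point set"
  assumes S: "finite S"
  shows "finite (cuts len S e)"
proof -
  have "{t. 0 < t \<and> t < len e \<and> Inner e t \<in> S} \<subseteq> position e ` S"
    by (auto intro!: image_eqI[where x = "Inner e _"])
  with S show ?thesis
    by (auto simp: cuts_def intro: finite_subset)
qed

lemma cuts_subset: "e \<in> arcs G \<Longrightarrow> cuts len S e \<subseteq> {0..len e}"
  using less_imp_le[OF len_pos] by (auto simp: cuts_def)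

lemma edge_pt_cuts:
  assumes "e \<in> arcs G" "Vertex ` verts G \<subseteq> S" "t \<in> cuts len S e"
  shows "edge_pt G len e t \<in> S"
  using assms len_pos[OF assms(1)] by (auto simp: cuts_def edge_pt_def)

text \<open>The energy pairing of the subdivided circuit. Tested against a node's indicator it gives
  the net current there, so Kirchhoff's law becomes a weak equation.\<close>

definition network_form ::
    "('a, 'b) mg_point set \<Rightarrow> (('a, 'b) mg_point \<Rightarrow> real) \<Rightarrow> (('a, 'b) mg_point \<Rightarrow> real) \<Rightarrow> real" where
  "network_form S f h = (\<Sum>(e, a, b)\<in>segments G len S.
     (f (edge_pt G len e a) - f (edge_pt G len e b)) / (b - a) *
     (h (edge_pt G len e a) - h (edge_pt G len e b)))"

lemma net_current_eq_network_form:
  "net_current G len S f p = network_form S f (\<lambda>z. of_bool (z = p))"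
  by (simp add: net_current_def network_form_def)

lemma network_form_commute: "network_form S f h = network_form S h f"
  by (simp add: network_form_def mult.commute)

lemma network_form_diff_left:
  "network_form S (\<lambda>z. f z - f' z) h = network_form S f h - network_form S f' h"
  unfolding network_form_def sum_subtractf[symmetric]
  by (intro sum.cong) (auto simp: algebra_simps diff_divide_distrib add_divide_distrib)

lemma network_form_eq_sum_net_current:
  assumes S: "finite S" "Vertex ` verts G \<subseteq> S"
  shows "network_form S f h = (\<Sum>p\<in>S. h p * net_current G len S f p)"
proof -
  have val: "(\<Sum>p\<in>S. h p * of_bool (z = p)) = h z" if "z \<in> S" for z
    using that S by (simp add: of_bool_def if_distrib cong: if_cong)
  have ends: "edge_pt G len e a \<in> S" "edge_pt G len e b \<in> S" if "(e, a, b) \<in> segments G len S" for e a b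
    using that edge_pt_cuts S by (auto simp: segments_def)
  have "(\<Sum>p\<in>S. h p * net_current G len S f p)
      = (\<Sum>(e, a, b)\<in>segments G len S. \<Sum>p\<in>S. h p *
          ((f (edge_pt G len e a) - f (edge_pt G len e b)) / (b - a) *
           (of_bool (edge_pt G len e a = p) - of_bool (edge_pt G len e b = p))))"
    unfolding net_current_def sum_distrib_left
    by (subst sum.swap) (simp add: case_prod_unfold)
  also have "\<dots> = (\<Sum>(e, a, b)\<in>segments G len S.
          (f (edge_pt G len e a) - f (edge_pt G len e b)) / (b - a) *
           ((\<Sum>p\<in>S. h p * of_bool (edge_pt G len e a = p))
            - (\<Sum>p\<in>S. h p * of_bool (edge_pt G len e b = p))))"
    unfolding sum_subtractf[symmetric] sum_distrib_left
    by (intro sum.cong refl)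
      (auto intro!: sum.cong simp: algebra_simps diff_divide_distrib add_divide_distrib)
  also have "\<dots> = network_form S f h"
    unfolding network_form_def by (intro sum.cong refl) (auto simp: val ends)
  finally show ?thesis by simp
qed

text \<open>Uniqueness of the resistance is reciprocity: if \<open>f\<close> and \<open>h\<close> are potentials of the same
  current, then \<open>f x - f y\<close> and \<open>h x - h y\<close> both equal the symmetric pairing of \<open>f\<close> and \<open>h\<close>.\<close>

lemma eff_resistance_eqI:
  assumes f: "unit_current_potential G len (Vertex ` verts G \<union> {x, y}) x y f"
  shows "eff_resistance G len x y = f x - f y"
proof -
  let ?S = "Vertex ` verts G \<union> {x, y}"
  have pair: "network_form ?S f h = h x - h y"
    if "unit_current_potential G len ?S x y f" for f h
  proof -
    have "network_form ?S f h = (\<Sum>p\<in>?S. h p * net_current G len ?S f p)"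
      by (rule network_form_eq_sum_net_current) auto
    also have "\<dots> = (\<Sum>p\<in>?S. h p * (of_bool (p = x) - of_bool (p = y)))"
      using that by (intro sum.cong) (auto simp: unit_current_potential_def)
    also have "\<dots> = (\<Sum>p\<in>?S. if p = x then h p else 0) - (\<Sum>p\<in>?S. if p = y then h p else 0)"
      unfolding sum_subtractf[symmetric] by (intro sum.cong) auto
    also have "\<dots> = h x - h y"
      by (subst (1 2) sum.delta) auto
    finally show ?thesis .
  qed
  show ?thesis
    unfolding eff_resistance_def
  proof (rule the_equality)
    fix r assume "\<exists>h. unit_current_potential G len ?S x y h \<and> r = h x - h y"
    then show "r = f x - f y"
      using pair pair[OF f] network_form_commute by metis
  qed (use f in blast)
qed

end

section \<open>Potentials from the Green matrix\<close>

text \<open>Row \<open>p\<close> of \<open>Q\<close> is the zero-mean vertex potential of a unit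
  source at \<open>p\<close> drained equally through all vertices.\<close>

locale green_graph = metrized_graph +
  fixes Q :: "'a \<Rightarrow> 'a \<Rightarrow> real"
  assumes sum_green: "p \<in> verts G \<Longrightarrow> sum (Q p) (verts G) = 0"
    and dirichlet_green:
      "p \<in> verts G \<Longrightarrow> dirichlet (Q p) h = h p - sum h (verts G) / card (verts G)"
begin

text \<open>Both entries equal the energy pairing of rows \<open>p\<close> and
  \<open>q\<close>.\<close>

lemma green_commute:
  assumes "p \<in> verts G" "q \<in> verts G"
  shows "Q p q = Q q p"
  using dirichlet_green[of p "Q q"] dirichlet_green[of q "Q p"] sum_green assms
  by (simp add: dirichlet_commute)

text \<open>The vertex potential generated by a unit current at \<open>x\<close> that leaves uniformly through
  all vertices.\<close>

definition vertex_potential :: "('a, 'b) mg_point \<Rightarrow> 'a \<Rightarrow> real" where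
  "vertex_potential x p = interp (\<lambda>q. Q q p) x"

lemma vertex_potential_Vertex: "vertex_potential (Vertex p) = Q p"
  by (simp add: vertex_potential_def fun_eq_iff)

lemma vertex_potential_Inner:
  "vertex_potential (Inner e t) = (\<lambda>p. (1 - t / len e) * Q (tail G e) p + t / len e * Q (head G e) p)"
  by (simp add: vertex_potential_def fun_eq_iff)

lemma dirichlet_vertex_potential:
  assumes "x \<in> mg_points G len"
  shows "dirichlet (vertex_potential x) h = interp h x - sum h (verts G) / card (verts G)"
  using assms
proof (cases rule: mg_points_cases)
  case (Vertex p)
  then show ?thesis
    using dirichlet_green[of p h] by (simp add: vertex_potential_Vertex)
next
  case (Inner e t)
  then show ?thesis
    unfolding Inner(1) vertex_potential_Inner dirichlet_linear_left
    by (simp add: dirichlet_green algebra_simps add_divide_distrib diff_divide_distrib)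
qed

lemma sum_vertex_potential:
  assumes "x \<in> mg_points G len"
  shows "sum (vertex_potential x) (verts G) = 0"
  using assms
proof (cases rule: mg_points_cases)
  case (Inner e t)
  then show ?thesis
    unfolding Inner(1) vertex_potential_Inner sum.distrib sum_distrib_left[symmetric]
    by (simp add: sum_green)
qed (simp add: vertex_potential_Vertex sum_green)

text \<open>Reciprocity: symmetry of \<open>Q\<close> exchanges the source and the point of
  evaluation.\<close>

lemma interp_vertex_potential_Inner:
  assumes y: "y \<in> mg_points G len" and e: "e \<in> arcs G"
  shows "interp (vertex_potential (Inner e t)) y
    = (1 - t / len e) * vertex_potential y (tail G e) + t / len e * vertex_potential y (head G e)"
proof -
  have "interp (Q p) y = vertex_potential y p" if "p \<in> verts G" for p
    unfolding vertex_potential_def using that y by (intro interp_cong green_commute)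
  with e show ?thesis
    unfolding vertex_potential_Inner interp_linear by simp
qed

text \<open>The Green function on the whole metrized graph, with source \<open>x\<close> and uniform
  drain at the vertices. The bump restores the kink at an interior source that affine interpolation
  loses.\<close>

definition potential :: "('a, 'b) mg_point \<Rightarrow> ('a, 'b) mg_point \<Rightarrow> real" where
  "potential x z = interp (vertex_potential x) z +
     (case z of Vertex p \<Rightarrow> 0 | Inner e t \<Rightarrow> bump (len e) (position e x) t)"

lemma potential_edge_pt:
  assumes x: "x \<in> mg_points G len" and e: "e \<in> arcs G" and t: "0 \<le> t" "t \<le> len e"
  shows "potential x (edge_pt G len e t) = vertex_potential x (tail G e)
    + (vertex_potential x (head G e) - vertex_potential x (tail G e)) / len e * t
    + bump (len e) (position e x) t"
proof -
  have L: "0 < len e" by (rule len_pos[OF e])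
  have s: "0 \<le> position e x" "position e x \<le> len e"
    using position_bounds[OF e x] by auto
  consider "t = 0" | "t = len e" | "0 < t" "t < len e" using t by linarith
  then show ?thesis
    using L s by cases (simp_all add: edge_pt_def potential_def bump_ends field_simps)
qed

text \<open>The affine parts add up to \<open>dirichlet (vertex_potential x)\<close>, giving the
  interpolated value of \<open>h\<close> at \<open>x\<close> minus the vertex mean. The kink at
  \<open>x\<close> supplies the difference between \<open>h x\<close> and that interpolated
  value.\<close>

lemma network_form_potential:
  assumes S: "finite S" "x \<in> S" and x: "x \<in> mg_points G len"
  shows "network_form S (potential x) h
    = h x - (\<Sum>p\<in>verts G. h (Vertex p)) / card (verts G)"
proof -
  \<comment> \<open>The deviation of \<open>h\<close> from affine interpolation along
    \<open>e\<close>.\<close>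
  define jump where "jump e s = h (edge_pt G len e s)
    - (1 - s / len e) * h (Vertex (tail G e)) - s / len e * h (Vertex (head G e))" for e s
  have edge: "(\<Sum>(a, b)\<in>consecutive_pairs (cuts len S e).
        (potential x (edge_pt G len e a) - potential x (edge_pt G len e b)) / (b - a) *
        (h (edge_pt G len e a) - h (edge_pt G len e b)))
      = (vertex_potential x (head G e) - vertex_potential x (tail G e))
          * (h (Vertex (head G e)) - h (Vertex (tail G e))) / len e + jump e (position e x)"
    if e: "e \<in> arcs G" for e
  proof -
    let ?C = "cuts len S e" and ?u = "vertex_potential x"
    have L: "0 < len e" by (rule len_pos[OF e])
    have C: "finite ?C" "?C \<subseteq> {0..len e}" "0 \<in> ?C" "len e \<in> ?C"
      using finite_cuts[OF S(1)] cuts_subset[OF e] by (auto simp: cuts_def)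
    have s: "position e x \<in> ?C"
      using x S(2) by (cases rule: mg_points_cases) (auto simp: cuts_def)
    have pot: "potential x (edge_pt G len e a)
        = ?u (tail G e) + (?u (head G e) - ?u (tail G e)) / len e * a + bump (len e) (position e x) a"
      if "a \<in> ?C" for a
      using potential_edge_pt[OF x e] that C by auto
    have "(\<Sum>(a, b)\<in>consecutive_pairs ?C.
        (potential x (edge_pt G len e a) - potential x (edge_pt G len e b)) / (b - a) *
        (h (edge_pt G len e a) - h (edge_pt G len e b)))
      = (\<Sum>(a, b)\<in>consecutive_pairs ?C.
        (?u (tail G e) + (?u (head G e) - ?u (tail G e)) / len e * a + bump (len e) (position e x) a
         - (?u (tail G e) + (?u (head G e) - ?u (tail G e)) / len e * b + bump (len e) (position e x) b))
          / (b - a) * (h (edge_pt G len e a) - h (edge_pt G len e b)))"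
      by (intro sum.cong refl) (auto simp: consecutive_pairs_def pot)
    also have "\<dots> = (?u (head G e) - ?u (tail G e)) / len e
        * (h (edge_pt G len e (len e)) - h (edge_pt G len e 0))
        + (h (edge_pt G len e (position e x)) - (1 - position e x / len e) * h (edge_pt G len e 0)
           - position e x / len e * h (edge_pt G len e (len e)))"
      by (rule sum_consecutive_pairs_bump[OF C s L])
    also have "\<dots> = (?u (head G e) - ?u (tail G e))
          * (h (Vertex (head G e)) - h (Vertex (tail G e))) / len e + jump e (position e x)"
      using L by (simp add: jump_def edge_pt_def)
    finally show ?thesis .
  qed
  have "network_form S (potential x) h = (\<Sum>e\<in>arcs G. \<Sum>(a, b)\<in>consecutive_pairs (cuts len S e).
        (potential x (edge_pt G len e a) - potential x (edge_pt G len e b)) / (b - a) *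
        (h (edge_pt G len e a) - h (edge_pt G len e b)))"
    unfolding network_form_def segments_eq_Sigma
    by (subst sum.Sigma) (auto intro: finite_consecutive_pairs finite_cuts S)
  also have "\<dots> = dirichlet (vertex_potential x) (\<lambda>p. h (Vertex p))
      + (\<Sum>e\<in>arcs G. jump e (position e x))"
    unfolding dirichlet_def sum.distrib[symmetric] by (intro sum.cong refl edge)
  also have "(\<Sum>e\<in>arcs G. jump e (position e x)) = (case x of Vertex p \<Rightarrow> 0 | Inner e t \<Rightarrow> jump e t)"
    by (rule sum_arcs_position[OF x]) (simp add: jump_def edge_pt_def)
  also have "\<dots> = h x - interp (\<lambda>p. h (Vertex p)) x"
    using x by (cases rule: mg_points_cases) (simp_all add: jump_def edge_pt_def)
  finally show ?thesis
    by (simp add: dirichlet_vertex_potential[OF x])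
qed

text \<open>The uniform drains of the sources \<open>x\<close> and \<open>y\<close> cancel in the
  difference of their potentials.\<close>

lemma eff_resistance_eq_potential:
  assumes x: "x \<in> mg_points G len" and y: "y \<in> mg_points G len"
  shows "eff_resistance G len x y = potential x x - potential y x - potential x y + potential y y"
proof -
  have "unit_current_potential G len (Vertex ` verts G \<union> {x, y}) x y (\<lambda>z. potential x z - potential y z)"
    unfolding unit_current_potential_def net_current_eq_network_form network_form_diff_left
    using x y by (auto simp: network_form_potential)
  from eff_resistance_eqI[OF this] show ?thesis by simp
qed

section \<open>Resistance along an edge and the tau constant\<close>

definition edge_resistance :: "'b \<Rightarrow> real" where
  "edge_resistance e = Q (tail G e) (tail G e) + Q (head G e) (head G e) - 2 * Q (tail G e) (head G e)"

text \<open>The form required by \<open>integral_square_deriv_bump\<close>. The quadratic part comes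
  from \<open>potential x x\<close> alone: interpolating \<open>Q\<close> in both arguments falls
  short of interpolating its diagonal by \<open>l * (1 - l) * edge_resistance e\<close>, and the
  bump at its own source adds \<open>t * (len e - t) / len e\<close>.\<close>

lemma eff_resistance_on_edge:
  fixes y :: "('a, 'b) mg_point" and e :: 'b
  defines "u \<equiv> \<lambda>p. Q p p - 2 * vertex_potential y p"
  assumes y: "y \<in> mg_points G len" and e: "e \<in> arcs G" and t: "0 < t" "t < len e"
  shows "eff_resistance G len (edge_pt G len e t) y
    = (u (tail G e) + potential y y) + (u (head G e) - u (tail G e)) / len e * t
      + (1 - edge_resistance e / len e) * (t * (len e - t) / len e) - 2 * bump (len e) (position e y) t"
proof -
  define x :: "('a, 'b) mg_point" where "x = Inner e t"
  have x: "x \<in> mg_points G len" "edge_pt G len e t = x"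
    using e t by (auto simp: x_def mg_points_def edge_pt_def)
  define l where "l = t / len e"
  have L: "0 < len e" by (rule len_pos[OF e])
  have "Q (head G e) (tail G e) = Q (tail G e) (head G e)"
    using e by (intro green_commute) auto
  then have "potential x x = (1 - l) * Q (tail G e) (tail G e) + l * Q (head G e) (head G e)
      - l * (1 - l) * edge_resistance e + bump (len e) t t"
    by (simp add: potential_def x_def vertex_potential_def edge_resistance_def l_def[symmetric]
        algebra_simps)
  moreover have "bump (len e) t t = t * (len e - t) / len e"
    by (simp add: bump_def)
  moreover have "potential y x = (1 - l) * vertex_potential y (tail G e)
      + l * vertex_potential y (head G e) + bump (len e) (position e y) t"
    by (simp add: potential_def x_def l_def)
  moreover have "potential x y = (1 - l) * vertex_potential y (tail G e)
      + l * vertex_potential y (head G e) + bump (len e) (position e y) t"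
    using y t unfolding potential_def x_def interp_vertex_potential_Inner[OF y e] l_def
    by (cases rule: mg_points_cases) (auto simp: bump_commute bump_zero bump_ends)
  moreover have "(1 - edge_resistance e / len e) * (t * (len e - t) / len e)
      = t * (len e - t) / len e - l * (1 - l) * edge_resistance e"
    using L by (simp add: l_def field_simps)
  moreover have "(u (head G e) - u (tail G e)) / len e * t = l * (u (head G e) - u (tail G e))"
    by (simp add: l_def)
  ultimately show ?thesis
    unfolding x(2) eff_resistance_eq_potential[OF x(1) y]
    by (simp only:) (simp add: u_def algebra_simps)
qed

text \<open>The base point disappears because the term from the edge containing \<open>y\<close>
  cancels the \<open>y\<close>-dependent terms of \<open>dirichlet u u\<close>.\<close>

lemma tau_constant_eq:
  assumes y: "y \<in> mg_points G len"
  shows "tau_constant G len y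
    = 1 / 12 * (\<Sum>e\<in>arcs G. len e * (1 - edge_resistance e / len e)\<^sup>2)
      + 1 / 4 * dirichlet (\<lambda>p. Q p p) (\<lambda>p. Q p p) + (\<Sum>p\<in>verts G. Q p p) / card (verts G)"
proof -
  define D where "D = (\<lambda>p. Q p p)"
  define u where "u = (\<lambda>p. D p - 2 * vertex_potential y p)"
  have "integral {0..len e} (\<lambda>t. (deriv (\<lambda>s. eff_resistance G len (edge_pt G len e s) y) t)\<^sup>2)
      = (u (head G e) - u (tail G e)) * (u (head G e) - u (tail G e)) / len e
        + 1 / 3 * (len e * (1 - edge_resistance e / len e)\<^sup>2)
        + 4 * (edge_resistance e / len e * (position e y * (len e - position e y) / len e))"
    if e: "e \<in> arcs G" for e
    using len_pos[OF e]
    by (subst integral_square_deriv_bump[OF position_bounds[OF e y] eff_resistance_on_edge[OF y e]])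
      (simp_all add: u_def D_def power2_eq_square mult_ac)
  then have "tau_constant G len y = 1 / 4 * (\<Sum>e\<in>arcs G.
        (u (head G e) - u (tail G e)) * (u (head G e) - u (tail G e)) / len e
        + 1 / 3 * (len e * (1 - edge_resistance e / len e)\<^sup>2)
        + 4 * (edge_resistance e / len e * (position e y * (len e - position e y) / len e)))"
    unfolding tau_constant_def by simp
  also have "\<dots> = 1 / 4 * dirichlet u u
      + 1 / 12 * (\<Sum>e\<in>arcs G. len e * (1 - edge_resistance e / len e)\<^sup>2)
      + (\<Sum>e\<in>arcs G. edge_resistance e / len e * (position e y * (len e - position e y) / len e))"
    unfolding sum.distrib sum_distrib_left[symmetric] dirichlet_def by (simp only: distrib_left)
  also have "(\<Sum>e\<in>arcs G. edge_resistance e / len e * (position e y * (len e - position e y) / len e))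
      = (case y of Vertex p \<Rightarrow> 0 | Inner e s \<Rightarrow> edge_resistance e / len e * (s * (len e - s) / len e))"
    by (rule sum_arcs_position[OF y]) simp
  \<comment> \<open>Again the gap between interpolating the diagonal and interpolating
    \<open>Q\<close> in both arguments.\<close>
  also have "\<dots> = interp D y - interp (vertex_potential y) y"
    using y
  proof (cases rule: mg_points_cases)
    case (Inner e s)
    have "Q (head G e) (tail G e) = Q (tail G e) (head G e)"
      using Inner by (intro green_commute) auto
    with Inner show ?thesis
      by (simp add: D_def vertex_potential_def edge_resistance_def field_simps)
  qed (simp add: D_def vertex_potential_def)
  also have "dirichlet u u = dirichlet D D
      - 4 * (interp D y - sum D (verts G) / card (verts G)) + 4 * interp (vertex_potential y) y"
    unfolding u_def dirichlet_diff_self dirichlet_vertex_potential[OF y] sum_vertex_potential[OF y]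
    by simp
  finally show ?thesis
    by (simp add: D_def algebra_simps)
qed

section \<open>Foster's identity and the trace bound\<close>

lemma sum_dirichlet_green:
  "(\<Sum>p\<in>verts G. dirichlet (Q p) (\<lambda>q. of_bool (q = p))) = real (card (verts G)) - 1"
  using verts_nonempty by (simp add: dirichlet_green field_simps)

text \<open>The trace of the Laplacian times \<open>Q\<close> is computed twice: as the trace of
  \<open>I - J / v\<close>, and arc by arc.\<close>

lemma foster: "(\<Sum>e\<in>arcs G. edge_resistance e / len e) = real (card (verts G)) - 1"
proof -
  have val: "(\<Sum>p\<in>verts G. f p * of_bool (q = p)) = f q" if "q \<in> verts G" for q and f :: "'a \<Rightarrow> real"
    using that by (simp add: of_bool_def if_distrib cong: if_cong)
  have "(\<Sum>p\<in>verts G. dirichlet (Q p) (\<lambda>q. of_bool (q = p)))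
     = (\<Sum>e\<in>arcs G. \<Sum>p\<in>verts G. (Q p (head G e) - Q p (tail G e))
           * (of_bool (head G e = p) - of_bool (tail G e = p)) / len e)"
    unfolding dirichlet_def by (rule sum.swap)
  also have "\<dots> = (\<Sum>e\<in>arcs G. ((\<Sum>p\<in>verts G. (Q p (head G e) - Q p (tail G e)) * of_bool (head G e = p))
       - (\<Sum>p\<in>verts G. (Q p (head G e) - Q p (tail G e)) * of_bool (tail G e = p))) / len e)"
    unfolding sum_subtractf[symmetric] sum_divide_distrib right_diff_distrib ..
  also have "\<dots> = (\<Sum>e\<in>arcs G. edge_resistance e / len e)"
    using green_commute by (intro sum.cong refl) (simp add: val edge_resistance_def)
  finally show ?thesis
    by (simp add: sum_dirichlet_green)
qed

lemma trace_green_lower_bound: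
  fixes c :: real
  shows "2 * c * (real (card (verts G)) - 1) - c\<^sup>2 * (\<Sum>e\<in>arcs G. 2 / len e) \<le> (\<Sum>p\<in>verts G. Q p p)"
proof -
  define one :: "'a \<Rightarrow> 'a \<Rightarrow> real" where "one = (\<lambda>p q. of_bool (q = p))"
  \<comment> \<open>The energy of \<open>Q p - c \<cdot> 1\<^sub>p\<close> is nonnegative; optimising over \<open>c\<close> replaces Cauchy--Schwarz.\<close>
  have "0 \<le> Q p p - 2 * c * dirichlet (Q p) (one p) + c\<^sup>2 * dirichlet (one p) (one p)"
    if p: "p \<in> verts G" for p
    using dirichlet_self_nonneg[of "\<lambda>q. Q p q - c * one p q"] dirichlet_green[OF p, of "Q p"] sum_green[OF p]
    unfolding dirichlet_diff_self dirichlet_commute[of "one p" "Q p"] by simp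
  then have "0 \<le> (\<Sum>p\<in>verts G. Q p p - 2 * c * dirichlet (Q p) (one p) + c\<^sup>2 * dirichlet (one p) (one p))"
    by (rule sum_nonneg)
  also have "\<dots> = (\<Sum>p\<in>verts G. Q p p) - 2 * c * (real (card (verts G)) - 1)
      + c\<^sup>2 * (\<Sum>p\<in>verts G. dirichlet (one p) (one p))"
    using sum_dirichlet_green
    by (simp add: one_def sum.distrib sum_subtractf sum_distrib_left[symmetric])
  also have "(\<Sum>p\<in>verts G. dirichlet (one p) (one p)) \<le> (\<Sum>e\<in>arcs G. 2 / len e)"
  proof -
    have "(\<Sum>p\<in>verts G. dirichlet (one p) (one p)) = (\<Sum>e\<in>arcs G.
        (\<Sum>p\<in>verts G. (one p (head G e) - one p (tail G e)) * (one p (head G e) - one p (tail G e))) / len e)"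
      unfolding dirichlet_def sum_divide_distrib by (rule sum.swap)
    also have "\<dots> \<le> (\<Sum>e\<in>arcs G. 2 / len e)"
    proof (intro sum_mono divide_right_mono)
      fix e assume e: "e \<in> arcs G"
      \<comment> \<open>A self-loop gives 0 and any other arc gives 2; the bound covers
        both.\<close>
      have "(\<Sum>p\<in>verts G. (one p (head G e) - one p (tail G e)) * (one p (head G e) - one p (tail G e)))
          \<le> (\<Sum>p\<in>verts G. one p (head G e) + one p (tail G e))"
        by (intro sum_mono) (simp add: one_def)
      also have "\<dots> = 2"
        using e by (simp add: sum.distrib one_def of_bool_def)
      finally show "(\<Sum>p\<in>verts G. (one p (head G e) - one p (tail G e)) * (one p (head G e) - one p (tail G e))) \<le> 2" .
    qed (use len_pos in \<open>simp add: less_imp_le\<close>)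
    finally show ?thesis .
  qed
  finally show ?thesis by (simp add: mult_left_mono)
qed

end

section \<open>The inequality for equal edge lengths\<close>

lemma (in metrized_graph) ex_green_graph: "\<exists>Q. green_graph G len Q"
proof -
  have "\<exists>Q. \<forall>p\<in>verts G. sum (Q p) (verts G) = 0 \<and>
      (\<forall>h. dirichlet (Q p) h = h p - sum h (verts G) / card (verts G))"
    using ex_green_function_at by (intro bchoice) blast
  then show ?thesis
    by (auto simp: green_graph_def green_graph_axioms_def metrized_graph_axioms)
qed

theorem theorem2p27:
  fixes G :: "('a, 'b) pre_digraph"
    and len :: "'b \<Rightarrow> real"
    and v e :: nat
    and g :: int
    and y :: "('a, 'b) mg_point"
  assumes "metrized_graph G len"
    and "total_length G len = 1"
    and "v = card (verts G)"
    and "e = card (arcs G)"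
    and "\<And>a. a \<in> arcs G \<Longrightarrow> len a = 1 / real e"
    and "g = int e - int v + 1"
    and "y \<in> mg_points G len"
  shows "tau_constant G len y \<ge>
           1 / 12 * (real_of_int g / real e)\<^sup>2 + 1 / (2 * real v) * ((real v - 1) / real e)\<^sup>2"
proof -
  obtain Q where "green_graph G len Q"
    using metrized_graph.ex_green_graph[OF assms(1)] by blast
  then interpret green_graph G len Q .
  have "e \<noteq> 0"
    using assms(2,4) by (auto simp: total_length_def)
  then have e: "0 < real e" by simp
  have v: "0 < real v"
    using card_verts_pos assms(3) by simp
  have first: "(real_of_int g / real e)\<^sup>2 \<le> (\<Sum>a\<in>arcs G. len a * (1 - edge_resistance a / len a)\<^sup>2)"
  proof -
    \<comment> \<open>By Foster's identity the sum is \<open>e - (v - 1)\<close>.\<close>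
    have "(\<Sum>a\<in>arcs G. 1 - edge_resistance a / len a) = real_of_int g"
      using assms(3,4,6) by (simp add: sum_subtractf foster)
    then have "(real_of_int g)\<^sup>2 \<le> real e * (\<Sum>a\<in>arcs G. (1 - edge_resistance a / len a)\<^sup>2)"
      using Cauchy_Schwarz_ineq_sum[of "\<lambda>_. 1" "\<lambda>a. 1 - edge_resistance a / len a" "arcs G"] assms(4)
      by simp
    moreover have "(\<Sum>a\<in>arcs G. len a * (1 - edge_resistance a / len a)\<^sup>2)
        = (\<Sum>a\<in>arcs G. (1 - edge_resistance a / len a)\<^sup>2) / real e"
      unfolding sum_divide_distrib by (intro sum.cong refl) (simp add: assms(5))
    ultimately show ?thesis
      using e by (simp add: power_divide power2_eq_square field_simps)
  qed
  have second: "1 / 2 * ((real v - 1) / real e)\<^sup>2 \<le> (\<Sum>p\<in>verts G. Q p p)"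
  proof -
    have "(\<Sum>a\<in>arcs G. 2 / len a) = 2 * (real e)\<^sup>2"
      using assms(4) e by (simp add: assms(5) power2_eq_square)
    \<comment> \<open>This \<open>c\<close> maximises the concave quadratic on the left.\<close>
    moreover have "2 * c * (real v - 1) - c\<^sup>2 * (2 * (real e)\<^sup>2) = 1 / 2 * ((real v - 1) / real e)\<^sup>2"
      if "c = (real v - 1) / (2 * (real e)\<^sup>2)" for c
      unfolding that using e by (simp add: power2_eq_square field_simps)
    ultimately show ?thesis
      using trace_green_lower_bound[of "(real v - 1) / (2 * (real e)\<^sup>2)"] assms(3) by simp
  qed
  have "1 / (2 * real v) * ((real v - 1) / real e)\<^sup>2 \<le> (\<Sum>p\<in>verts G. Q p p) / real v"
    using divide_right_mono[OF second, of "real v"] v by (simp add: field_simps)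
  then show ?thesis
    unfolding tau_constant_eq[OF assms(7)] assms(3)[symmetric]
    using first dirichlet_self_nonneg[of "\<lambda>p. Q p p"] by linarith
qed

end
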